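(* Let $X$ be a finite set of positive integers such that $\mathcal{G}(X)$ is connected. Let $b$ be any vertex of $\mathcal{G}(X)$ and let $p$ be any prime dividing $b$. Then the map $\eta_*\colon\pi_1(\mathcal{G}(X),b)\to\pi_1(\mathcal{D}(X),p)$ is a group isomorphism.
   Context: An (abstract) simplicial complex is a pair $(\mathcal{V},\mathcal{S})$ with $\mathcal{V}$ a finite set of vertices and $\mathcal{S}$ a set of nonempty subsets of $\mathcal{V}$ (the simplices), containing all singletons and closed under taking nonempty subsets. For a set $X$ of positive integers put $X^*=X\setminus\{1\}$. The common divisor simplicial complex $\mathcal{G}(X)$ has vertex set $X^*$, and a nonempty $V\subseteq X^*$ is a simplex iff $\gcd(V)>1$. The prime divisor simplicial complex $\mathcal{D}(X)$ has as vertices the primes dividing at least one element of $X^*$, and a nonempty set $Q$ of such primes is a simplex iff some $v\in X$ is divisible by every element of $Q$. ($\mathcal{G}(X)$ is connected iff $\mathcal{D}(X)$ is connected.) For a simplex $\sigma$ of $\mathcal{G}(X)$, $\eta(\sigma)$ is the simplex of $\mathcal{D}(X)$ whose vertices are the primes dividing $\gcd(\sigma)$. Edge-paths. In a simplicial complex, an edge-path $\langle v_1,v_2\rangle\langle v_2,v_3\rangle\cdots\langle v_{n-1},v_n\rangle$ ($n\ge 2$) is a sequence of vertices $v_1,\dots,v_n$ such that each $\{v_i,v_{i+1}\}$ is a simplex ($v_i=v_{i+1}$ is allowed); it is an edge-loop based at $v_1$ if $v_1=v_n$. A simple equivalence replaces a segment $\langle v,w\rangle$ of an edge-path by $\langle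 v,u\rangle\langle u,w\rangle$, or vice versa, where $u,v,w$ are not necessarily distinct vertices contained in a common simplex. Two edge-paths are homotopic if one is obtained from the other by finitely many simple equivalences. $\pi_1(\mathcal{K},b)$ is the group of homotopy classes of edge-loops based at the vertex $b$, under concatenation (this is isomorphic to the topological fundamental group). The induced map. Let $b$ be a vertex of $\mathcal{G}(X)$ and $p$ a prime dividing $b$. For an edge-loop $\mathcal{L}=\langle v_1,v_2\rangle\cdots\langle v_{n-1},v_n\rangle$ in $\mathcal{G}(X)$ with $v_1=v_n=b$, choose for each $1\le i\le n-1$ a vertex $\omega_i$ of $\eta(\{v_i,v_{i+1}\})$, i.e. a prime dividing both $v_i$ and $v_{i+1}$. Then $\eta_*([\mathcal{L}])$ is the class in $\pi_1(\mathcal{D}(X),p)$ of the edge-loop $\langle p,\omega_1\rangle\langle\omega_1,\omega_2\rangle\cdots\langle\omega_{n-2},\omega_{n-1}\rangle\langle\omega_{n-1},p\rangle$; this class does not depend on the choices made. *)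

theory Defs
  imports "HOL-Algebra.Group" "HOL-Computational_Algebra.Primes"
begin

section \<open>Simplicial complexes and edge-paths\<close>

record 'a scomplex =
  vertices :: "'a set"
  simplices :: "'a set set"

definition simplicial_complex :: "'a scomplex \<Rightarrow> bool" where
  "simplicial_complex K \<longleftrightarrow>
     finite (vertices K) \<and>
     (\<forall>\<sigma>\<in>simplices K. \<sigma> \<noteq> {} \<and> \<sigma> \<subseteq> vertices K) \<and>
     (\<forall>v\<in>vertices K. {v} \<in> simplices K) \<and>
     (\<forall>\<sigma>\<in>simplices K. \<forall>\<tau>. \<tau> \<noteq> {} \<and> \<tau> \<subseteq> \<sigma> \<longrightarrow> \<tau> \<in> simplices K)"

text \<open>The edge-path \<open>\<langle>v\<^sub>1,v\<^sub>2\<rangle>\<dots>\<langle>v\<^sub>n\<^sub>-\<^sub>1,v\<^sub>n\<rangle>\<close> is represented by its list of vertices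
  \<open>[v\<^sub>1, \<dots>, v\<^sub>n]\<close>; since \<open>n \<ge> 2\<close>, the trivial path at \<open>v\<close> is \<open>[v, v]\<close>.\<close>

definition edge_path :: "'a scomplex \<Rightarrow> 'a list \<Rightarrow> bool" where
  "edge_path K P \<longleftrightarrow> 2 \<le> length P \<and> successively (\<lambda>v w. {v, w} \<in> simplices K) P"

definition edge_connected :: "'a scomplex \<Rightarrow> bool" where
  "edge_connected K \<longleftrightarrow>
     (\<forall>v\<in>vertices K. \<forall>w\<in>vertices K. \<exists>P. edge_path K P \<and> hd P = v \<and> last P = w)"

definition edge_loop :: "'a scomplex \<Rightarrow> 'a \<Rightarrow> 'a list \<Rightarrow> bool" where
  "edge_loop K b P \<longleftrightarrow> edge_path K P \<and> hd P = b \<and> last P = b"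

text \<open>A simple equivalence is a step of this relation in either direction. The vertices \<open>u\<close>, \<open>v\<close>, \<open>w\<close>
  need not be distinct.\<close>

inductive simple_insertion :: "'a scomplex \<Rightarrow> 'a list \<Rightarrow> 'a list \<Rightarrow> bool" for K where
  "\<sigma> \<in> simplices K \<Longrightarrow> {u, v, w} \<subseteq> \<sigma> \<Longrightarrow>
     simple_insertion K (xs @ [v, w] @ ys) (xs @ [v, u, w] @ ys)"

definition homotopic_paths :: "'a scomplex \<Rightarrow> 'a list \<Rightarrow> 'a list \<Rightarrow> bool" where
  "homotopic_paths K P Q \<longleftrightarrow>
     edge_path K P \<and> edge_path K Q \<and> equivclp (simple_insertion K) P Q"

definition loop_rel :: "'a scomplex \<Rightarrow> 'a \<Rightarrow> ('a list \<times> 'a list) set" where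
  "loop_rel K b = {(P, Q). edge_loop K b P \<and> edge_loop K b Q \<and> homotopic_paths K P Q}"

abbreviation loop_class :: "'a scomplex \<Rightarrow> 'a \<Rightarrow> 'a list \<Rightarrow> 'a list set" where
  "loop_class K b P \<equiv> loop_rel K b `` {P}"

text \<open>Concatenating loops at \<open>b\<close> identifies the last vertex of \<open>P\<close> with the first one of \<open>Q\<close>,
  whence \<open>P @ tl Q\<close>.\<close>

definition fundamental_group :: "'a scomplex \<Rightarrow> 'a \<Rightarrow> 'a list set monoid" where
  "fundamental_group K b =
     \<lparr>carrier = {P. edge_loop K b P} // loop_rel K b,
      monoid.mult = (\<lambda>A B. \<Union>P\<in>A. \<Union>Q\<in>B. loop_class K b (P @ tl Q)),
      one = loop_class K b [b, b]\<rparr>"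

lemma simple_insertion_facts:
  assumes K: "simplicial_complex K" and "simple_insertion K P Q"
  shows "hd P = hd Q \<and> last P = last Q \<and> (edge_path K P \<longleftrightarrow> edge_path K Q)"
  using assms(2)
proof cases
  case (1 \<sigma> u v w xs ys)
  have *: "\<And>\<tau>. \<tau> \<noteq> {} \<Longrightarrow> \<tau> \<subseteq> \<sigma> \<Longrightarrow> \<tau> \<in> simplices K"
    using K 1(3) unfolding simplicial_complex_def by blast
  have "{v, w} \<in> simplices K" "{v, u} \<in> simplices K" "{u, w} \<in> simplices K"
    using 1(4) by (auto intro!: *)
  then have "edge_path K P \<longleftrightarrow> edge_path K Q"
    unfolding 1(1,2) edge_path_def by (auto simp: successively_append_iff)
  then show ?thesis
    unfolding 1(1,2) by (cases xs) auto
qed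

lemma equivclp_insertion_facts:
  assumes K: "simplicial_complex K" and "equivclp (simple_insertion K) P Q"
  shows "hd P = hd Q \<and> last P = last Q \<and> (edge_path K P \<longleftrightarrow> edge_path K Q)"
  using assms(2)
proof (induction rule: equivclp_induct)
  case base
  show ?case by simp
next
  case (step Q R)
  then show ?case using simple_insertion_facts[OF K] by metis
qed

lemma equivclp_insertion_append:
  assumes "equivclp (simple_insertion K) P Q"
  shows "equivclp (simple_insertion K) (xs @ P @ ys) (xs @ Q @ ys)"
  using assms
proof (induction rule: equivclp_induct)
  case base
  show ?case by simp
next
  case (step Q R)
  have ins: "simple_insertion K (xs @ A @ ys) (xs @ B @ ys)" if "simple_insertion K A B" for A B
    using that
  proof cases
    case (1 \<sigma> u v w as bs)
    then show ?thesis using simple_insertion.intros[of \<sigma> K u v w "xs @ as" "bs @ ys"] by simp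
  qed
  show ?case using step ins by (meson equivclp_into_equivclp)
qed

lemma equiv_loop_rel: "equiv {P. edge_loop K b P} (loop_rel K b)"
  by (rule equivI)
    (auto simp: refl_on_def sym_def trans_def loop_rel_def homotopic_paths_def edge_loop_def
      intro: equivclp_sym equivclp_trans)

lemma edge_loop_append:
  assumes "edge_loop K b P" "edge_loop K b Q"
  shows "edge_loop K b (P @ tl Q)"
  using assms unfolding edge_loop_def edge_path_def
  by (cases Q; cases "tl Q") (auto simp: successively_append_iff hd_append)

lemma edge_loop_const: "simplicial_complex K \<Longrightarrow> b \<in> vertices K \<Longrightarrow> edge_loop K b [b, b]"
  by (simp add: edge_loop_def edge_path_def simplicial_complex_def)

lemma loop_rel_append:
  assumes "(P, P') \<in> loop_rel K b" "(Q, Q') \<in> loop_rel K b"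
  shows "(P @ tl Q, P' @ tl Q') \<in> loop_rel K b"
proof -
  let ?R = "equivclp (simple_insertion K)"
  have L: "edge_loop K b P" "edge_loop K b P'" "edge_loop K b Q" "edge_loop K b Q'"
    and R: "?R P P'" "?R Q Q'"
    using assms by (auto simp: loop_rel_def homotopic_paths_def)
  have split: "A @ tl B = butlast A @ B" if "edge_loop K b A" "edge_loop K b B" for A B
  proof -
    have "A \<noteq> []" "B \<noteq> []" "last A = b" "hd B = b"
      using that by (auto simp: edge_loop_def edge_path_def)
    then show ?thesis
      by (metis append.assoc append_Cons append_Nil append_butlast_last_id list.collapse)
  qed
  have "?R (P @ tl Q) (P' @ tl Q)"
    using equivclp_insertion_append[OF R(1), of "[]"] by simp
  moreover have "?R (P' @ tl Q) (P' @ tl Q')"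
    using equivclp_insertion_append[OF R(2), of "butlast P'" "[]"] L by (simp add: split)
  ultimately have "?R (P @ tl Q) (P' @ tl Q')" by (rule equivclp_trans)
  moreover have "edge_loop K b (P @ tl Q)" "edge_loop K b (P' @ tl Q')"
    using L by (simp_all add: edge_loop_append)
  ultimately show ?thesis
    by (simp add: loop_rel_def homotopic_paths_def edge_loop_def)
qed

lemma fundamental_group_mult:
  assumes "edge_loop K b P" "edge_loop K b Q"
  shows "loop_class K b P \<otimes>\<^bsub>fundamental_group K b\<^esub> loop_class K b Q = loop_class K b (P @ tl Q)"
proof -
  have "loop_class K b (P' @ tl Q') = loop_class K b (P @ tl Q)"
    if "P' \<in> loop_class K b P" "Q' \<in> loop_class K b Q" for P' Q'
  proof (rule equiv_class_eq[OF equiv_loop_rel, symmetric])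
    show "(P @ tl Q, P' @ tl Q') \<in> loop_rel K b"
      using that by (intro loop_rel_append) auto
  qed
  then have "(\<Union>P'\<in>loop_class K b P. \<Union>Q'\<in>loop_class K b Q. loop_class K b (P' @ tl Q')) =
      (\<Union>P'\<in>loop_class K b P. \<Union>Q'\<in>loop_class K b Q. loop_class K b (P @ tl Q))"
    by (intro SUP_cong refl)
  moreover have "P \<in> loop_class K b P" "Q \<in> loop_class K b Q"
    using assms by (simp_all add: loop_rel_def homotopic_paths_def edge_loop_def)
  then have "loop_class K b P \<noteq> {}" "loop_class K b Q \<noteq> {}"
    by (metis empty_iff)+
  ultimately show ?thesis by (simp add: fundamental_group_def)
qed

lemma path_rev_homotopic:
  assumes K: "simplicial_complex K" and "edge_path K P"
  shows "equivclp (simple_insertion K) (P @ tl (rev P)) [hd P, hd P]"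
  using assms(2)
proof (induction P)
  case Nil
  then show ?case by (simp add: edge_path_def)
next
  case (Cons v P)
  let ?R = "equivclp (simple_insertion K)"
  from Cons.prems obtain w ws where P: "P = w # ws"
    by (cases P) (auto simp: edge_path_def)
  have vw: "{v, w} \<in> simplices K"
    using Cons.prems P by (simp add: edge_path_def)
  have "simple_insertion K ([] @ [v, v] @ []) ([] @ [v, w, v] @ [])"
    by (rule simple_insertion.intros[OF vw]) auto
  then have a: "?R [v, w, v] [v, v]"
    by (simp add: equivclp_sym r_into_equivclp)
  have "simple_insertion K ([] @ [v, w] @ [v]) ([] @ [v, w, w] @ [v])"
    by (rule simple_insertion.intros[OF vw]) auto
  then have b: "?R [v, w, w, v] [v, w, v]"
    by (simp add: equivclp_sym r_into_equivclp)
  show ?case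
  proof (cases ws)
    case Nil
    then show ?thesis using a P by simp
  next
    case (Cons x xs)
    have "edge_path K P"
      using Cons.prems P Cons by (simp add: edge_path_def)
    then have "?R ([v] @ (P @ tl (rev P)) @ [v]) ([v] @ [hd P, hd P] @ [v])"
      by (intro equivclp_insertion_append Cons.IH)
    moreover have "[v] @ (P @ tl (rev P)) @ [v] = (v # P) @ tl (rev (v # P))"
      using P by (simp add: tl_append split: list.split)
    ultimately show ?thesis
      using P equivclp_trans[OF b a] by (auto intro: equivclp_trans)
  qed
qed

lemma group_fundamental_group:
  assumes K: "simplicial_complex K" and b: "b \<in> vertices K"
  shows "group (fundamental_group K b)" (is "group ?G")
proof (rule groupI)
  have car: "A \<in> carrier ?G \<longleftrightarrow> (\<exists>P. edge_loop K b P \<and> A = loop_class K b P)" for A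
    by (auto simp: fundamental_group_def quotient_def)
  have one: "\<one>\<^bsub>?G\<^esub> = loop_class K b [b, b]"
    by (simp add: fundamental_group_def)
  note const = edge_loop_const[OF K b]
  show "\<one>\<^bsub>?G\<^esub> \<in> carrier ?G"
    using car one const by blast
  fix x assume "x \<in> carrier ?G"
  then obtain P where P: "edge_loop K b P" "x = loop_class K b P" using car by blast
  have eq: "loop_class K b A = loop_class K b B"
    if "edge_loop K b A" "edge_loop K b B" "equivclp (simple_insertion K) A B" for A B
    using that by (intro equiv_class_eq[OF equiv_loop_rel])
      (auto simp: loop_rel_def homotopic_paths_def edge_loop_def)
  show "\<one>\<^bsub>?G\<^esub> \<otimes>\<^bsub>?G\<^esub> x = x"
  proof -
    obtain c cs where Pc: "P = b # c # cs"
      using P(1) by (cases P; cases "tl P") (auto simp: edge_loop_def edge_path_def)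
    have "{b, c} \<in> simplices K"
      using P(1) Pc by (simp add: edge_loop_def edge_path_def)
    then have "simple_insertion K ([] @ [b, c] @ cs) ([] @ [b, b, c] @ cs)"
      by (rule simple_insertion.intros) auto
    then have "equivclp (simple_insertion K) ([b, b] @ tl P) P"
      using Pc by (simp add: equivclp_sym r_into_equivclp)
    then show ?thesis
      using P eq const edge_loop_append fundamental_group_mult one by metis
  qed
  show "\<exists>y\<in>carrier ?G. y \<otimes>\<^bsub>?G\<^esub> x = \<one>\<^bsub>?G\<^esub>"
  proof -
    have rev: "edge_loop K b (rev P)"
      using P(1) by (auto simp: edge_loop_def edge_path_def hd_rev last_rev insert_commute)
    have "equivclp (simple_insertion K) (rev P @ tl P) [b, b]"
      using path_rev_homotopic[OF K, of "rev P"] rev by (auto simp: edge_loop_def)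
    then have "loop_class K b (rev P) \<otimes>\<^bsub>?G\<^esub> x = \<one>\<^bsub>?G\<^esub>"
      using P eq const edge_loop_append fundamental_group_mult one rev by metis
    then show ?thesis using car rev by blast
  qed
  fix y assume "y \<in> carrier ?G"
  then obtain Q where Q: "edge_loop K b Q" "y = loop_class K b Q" using car by blast
  show "x \<otimes>\<^bsub>?G\<^esub> y \<in> carrier ?G"
    using P Q car edge_loop_append fundamental_group_mult by metis
  fix z assume "z \<in> carrier ?G"
  then obtain R where R: "edge_loop K b R" "z = loop_class K b R" using car by blast
  have "Q \<noteq> []" using Q(1) by (auto simp: edge_loop_def edge_path_def)
  then show "x \<otimes>\<^bsub>?G\<^esub> y \<otimes>\<^bsub>?G\<^esub> z = x \<otimes>\<^bsub>?G\<^esub> (y \<otimes>\<^bsub>?G\<^esub> z)"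
    using P Q R by (simp add: fundamental_group_mult edge_loop_append)
qed


section \<open>The common divisor and prime divisor complexes\<close>

definition common_divisor_complex :: "nat set \<Rightarrow> nat scomplex" where
  "common_divisor_complex X =
     \<lparr>vertices = X - {1},
      simplices = {V. V \<noteq> {} \<and> V \<subseteq> X - {1} \<and> Gcd V > 1}\<rparr>"

definition prime_divisor_complex :: "nat set \<Rightarrow> nat scomplex" where
  "prime_divisor_complex X =
     \<lparr>vertices = {q. prime q \<and> (\<exists>x\<in>X - {1}. q dvd x)},
      simplices = {Q. Q \<noteq> {} \<and> Q \<subseteq> {q. prime q \<and> (\<exists>x\<in>X - {1}. q dvd x)} \<and>
                      (\<exists>v\<in>X. \<forall>q\<in>Q. q dvd v)}\<rparr>"

lemma simplicial_complex_common_divisor: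
  assumes "finite X" "\<forall>x\<in>X. 0 < x"
  shows "simplicial_complex (common_divisor_complex X)"
proof -
  have mono: "1 < Gcd T" if S: "1 < Gcd S" and T: "T \<noteq> {}" "T \<subseteq> S" "S \<subseteq> X" for S T :: "nat set"
  proof -
    obtain t where "t \<in> T" using T(1) by auto
    moreover from this have "0 < t" using T assms(2) by (meson subsetD)
    ultimately have "Gcd T \<noteq> 0" by (metis Gcd_dvd dvd_0_left_iff less_irrefl)
    moreover have "Gcd S dvd Gcd T"
      using T(2) by (intro Gcd_greatest Gcd_dvd) auto
    ultimately have "Gcd S \<le> Gcd T" by (metis dvd_imp_le neq0_conv)
    then show ?thesis using S by simp
  qed
  have single: "1 < Gcd {v}" if "v \<in> X" "v \<noteq> 1" for v
    using that(2) bspec[OF assms(2) that(1)] by simp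
  show ?thesis
    unfolding simplicial_complex_def common_divisor_complex_def scomplex.simps
  proof (intro conjI ballI allI impI)
    show "finite (X - {1})" using assms(1) by simp
  next
    fix \<sigma> \<tau> assume "\<sigma> \<in> {V. V \<noteq> {} \<and> V \<subseteq> X - {1} \<and> Gcd V > 1}" "\<tau> \<noteq> {} \<and> \<tau> \<subseteq> \<sigma>"
    then show "\<tau> \<in> {V. V \<noteq> {} \<and> V \<subseteq> X - {1} \<and> Gcd V > 1}"
      using mono[of \<sigma> \<tau>] by blast
  next
    fix v assume "v \<in> X - {1}"
    then show "{v} \<in> {V. V \<noteq> {} \<and> V \<subseteq> X - {1} \<and> Gcd V > 1}"
      using single[of v] by blast
  qed blast+
qed

lemma simplicial_complex_prime_divisor:
  assumes "finite X" "\<forall>x\<in>X. 0 < x"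
  shows "simplicial_complex (prime_divisor_complex X)"
proof -
  have "{q. prime q \<and> (\<exists>x\<in>X - {1}. q dvd x)} \<subseteq> (\<Union>x\<in>X. {..x})"
    using assms(2) by (auto dest: dvd_imp_le)
  then have "finite {q. prime q \<and> (\<exists>x\<in>X - {1}. q dvd x)}"
    by (rule finite_subset) (use assms(1) in auto)
  then show ?thesis
    by (auto simp: simplicial_complex_def prime_divisor_complex_def)
qed


section \<open>The induced map on fundamental groups\<close>

definition eta :: "nat set \<Rightarrow> nat set" where
  "eta \<sigma> = {q. prime q \<and> q dvd Gcd \<sigma>}"

definition eta_choice :: "nat list \<Rightarrow> nat list \<Rightarrow> bool" where
  "eta_choice L \<omega> \<longleftrightarrow>
     length \<omega> = length L - 1 \<and> (\<forall>i<length \<omega>. \<omega> ! i \<in> eta {L ! i, L ! Suc i})"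

text \<open>The union ranges over all representatives \<open>L\<close> of the class \<open>A\<close> and all admissible choices of
  primes for \<open>L\<close>. As the class of the resulting loop does not depend on these choices, it is a union
  of copies of one and the same homotopy class.\<close>

definition eta_star :: "nat set \<Rightarrow> nat \<Rightarrow> nat list set \<Rightarrow> nat list set" where
  "eta_star X p A =
     (\<Union>L\<in>A. \<Union>\<omega>\<in>{\<omega>. eta_choice L \<omega>}. loop_class (prime_divisor_complex X) p (p # \<omega> @ [p]))"

end

theory Submission
  imports Defs
begin

text \<open>
  The statement is an instance of Dowker duality. A relation \<open>R\<close> between two sets gives two complexes:
  sets of left-hand elements that are all related to one common right-hand element, and sets of
  right-hand elements that are all related to one common left-hand element. For the relation
  ``\<open>v \<in> X\<close> is divisible by the prime \<open>q\<close>'' these are \<open>\<G>(X)\<close> and \<open>\<D>(X)\<close>. It thus suffices to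
  show, for any relation between finite sets and any related pair \<open>b\<close>, \<open>p\<close> of base points, that the
  two complexes have isomorphic edge-path groups (\<open>witness_map_iso\<close>), by the map that replaces
  a loop \<open>L\<close> by a sequence \<open>\<omega>\<close> of witnesses for its edges, closed up with the base point \<open>p\<close>.

  The map is well defined because the successive witnesses that meet at a vertex \<open>v\<close> of \<open>L\<close> are all
  related to \<open>v\<close> and hence span a simplex of the other complex: this permits one choice of
  witnesses to be changed into another (\<open>witness_path_unique\<close>), and a vertex inserted into \<open>L\<close> to be
  matched by a repeated witness (\<open>witness_path_insertion\<close>).

  It is bijective because the construction is its own inverse. If \<open>\<omega>\<close> is a sequence of witnesses for
  \<open>L\<close>, then \<open>L\<close> itself is a sequence of witnesses for the closed-up path \<open>p, \<omega>, p\<close>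
  (\<open>witnesses_dual\<close>). Thus applying the construction for \<open>R\<close> and then the one for the converse
  relation leads from \<open>L\<close> to \<open>b, L, b\<close>, which is homotopic to \<open>L\<close> as \<open>L\<close> starts and ends in \<open>b\<close>.
\<close>

section \<open>Dowker complexes and sequences of witnesses\<close>

definition dowker :: "('a \<Rightarrow> 'b \<Rightarrow> bool) \<Rightarrow> 'a scomplex" where
  "dowker R = \<lparr>vertices = {x. \<exists>y. R x y}, simplices = {S. S \<noteq> {} \<and> (\<exists>y. \<forall>x\<in>S. R x y)}\<rparr>"

abbreviation path_equiv :: "'a scomplex \<Rightarrow> 'a list \<Rightarrow> 'a list \<Rightarrow> bool" where
  "path_equiv K \<equiv> equivclp (simple_insertion K)"

fun witnesses :: "('a \<Rightarrow> 'b \<Rightarrow> bool) \<Rightarrow> 'a list \<Rightarrow> 'b list \<Rightarrow> bool" where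
  "witnesses R [v] [] \<longleftrightarrow> True"
| "witnesses R (v # w # L) (q # \<omega>) \<longleftrightarrow> R v q \<and> R w q \<and> witnesses R (w # L) \<omega>"
| "witnesses R _ _ \<longleftrightarrow> False"

lemma edge_path_dowker_iff:
  "edge_path (dowker R) L \<longleftrightarrow> 2 \<le> length L \<and> (\<exists>\<omega>. witnesses R L \<omega>)"
proof -
  have "successively (\<lambda>v w. {v, w} \<in> simplices (dowker R)) L \<longleftrightarrow> (\<exists>\<omega>. witnesses R L \<omega>)"
    if "L \<noteq> []"
    using that
  proof (induction L rule: induct_list012)
    case (2 v)
    show ?case by (auto intro: exI[of _ "[]"])
  next
    case (3 v w L)
    have "(\<exists>\<omega>. witnesses R (v # w # L) \<omega>) \<longleftrightarrow>
        (\<exists>q. R v q \<and> R w q) \<and> (\<exists>\<omega>. witnesses R (w # L) \<omega>)"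
    proof
      assume "\<exists>\<omega>. witnesses R (v # w # L) \<omega>"
      then obtain \<omega> where "witnesses R (v # w # L) \<omega>" by blast
      then show "(\<exists>q. R v q \<and> R w q) \<and> (\<exists>\<omega>. witnesses R (w # L) \<omega>)"
        by (cases \<omega>) auto
    next
      assume "(\<exists>q. R v q \<and> R w q) \<and> (\<exists>\<omega>. witnesses R (w # L) \<omega>)"
      then obtain q \<omega> where "R v q" "R w q" "witnesses R (w # L) \<omega>" by blast
      then show "\<exists>\<omega>. witnesses R (v # w # L) \<omega>"
        by (intro exI[of _ "q # \<omega>"]) simp
    qed
    then show ?case using 3 by (simp add: dowker_def)
  qed simp
  then show ?thesis by (cases L) (auto simp: edge_path_def)
qed

lemma witnesses_append:
  assumes "witnesses R (xs @ [v]) \<alpha>" "witnesses R (v # ys) \<beta>"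
  shows "witnesses R (xs @ v # ys) (\<alpha> @ \<beta>)"
  using assms(1)
proof (induction xs arbitrary: \<alpha>)
  case Nil
  then show ?case using assms(2) by (cases \<alpha>) auto
next
  case (Cons x xs)
  then show ?case by (cases \<alpha>; cases xs) auto
qed

lemma witnesses_appendE:
  assumes "witnesses R (xs @ v # ys) \<omega>"
  obtains \<alpha> \<beta> where "\<omega> = \<alpha> @ \<beta>" "witnesses R (xs @ [v]) \<alpha>" "witnesses R (v # ys) \<beta>"
proof -
  have "\<exists>\<alpha> \<beta>. \<omega> = \<alpha> @ \<beta> \<and> witnesses R (xs @ [v]) \<alpha> \<and> witnesses R (v # ys) \<beta>"
    using assms
  proof (induction xs arbitrary: \<omega>)
    case Nil
    show ?case using Nil by (intro exI[of _ "[]"] exI[of _ \<omega>]) simp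
  next
    case (Cons x xs)
    from Cons.prems obtain q \<omega>' where \<omega>: "\<omega> = q # \<omega>'"
      by (cases \<omega>; cases xs) auto
    with Cons.prems have "witnesses R (xs @ v # ys) \<omega>'" by (cases xs) auto
    from Cons.IH[OF this] obtain \<alpha> \<beta> where
      "\<omega>' = \<alpha> @ \<beta>" "witnesses R (xs @ [v]) \<alpha>" "witnesses R (v # ys) \<beta>" by blast
    then show ?case using \<omega> Cons.prems
      by (intro exI[of _ "q # \<alpha>"] exI[of _ \<beta>]) (cases xs; auto)
  qed
  then show ?thesis using that by blast
qed

text \<open>Writing a path and its witnesses alternately as \<open>v\<^sub>1, \<omega>\<^sub>1, v\<^sub>2, \<omega>\<^sub>2, \<dots>, v\<^sub>n\<close>, neighbours are
  related by \<open>R\<close>. This condition does not distinguish the two kinds of entries, so after adding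
  \<open>p\<close> and \<open>r\<close> at the ends the two sequences may exchange their roles.\<close>

lemma witnesses_dual:
  assumes "witnesses R L \<omega>" "R (hd L) p" "R (last L) r"
  shows "witnesses (R\<inverse>\<inverse>) (p # \<omega> @ [r]) L"
  using assms by (induction R L \<omega> arbitrary: p rule: witnesses.induct) auto

lemma edge_path_witnesses:
  assumes "witnesses R L \<omega>" "R (hd L) p" "R (last L) r"
  shows "edge_path (dowker (R\<inverse>\<inverse>)) (p # \<omega> @ [r])"
  using witnesses_dual[OF assms] by (auto simp: edge_path_dowker_iff)


section \<open>Homotopies of witness paths\<close>

lemma path_equiv_insert:
  assumes "R u y" "R v y" "R w y"
  shows "path_equiv (dowker R) (xs @ v # w # ys) (xs @ v # u # w # ys)"
proof -
  have "{u, v, w} \<in> simplices (dowker R)" using assms by (auto simp: dowker_def)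
  from simple_insertion.intros[OF this subset_refl, of xs ys]
  show ?thesis by (simp add: r_into_equivclp)
qed

text \<open>This concerns the entry after \<open>p\<close> in a path \<open>p, \<omega>, r\<close>. For a single vertex, \<open>\<omega>\<close> is empty and
  that entry is \<open>r\<close>.\<close>

lemma witnesses_hd:
  assumes "witnesses R (v # L) \<omega>" "R (last (v # L)) r"
  shows "R v (hd (\<omega> @ [r]))"
  using assms by (cases L; cases \<omega>) auto

lemma path_equiv_insert_witness:
  assumes "witnesses R (v # L) \<omega>" "R (last (v # L)) r" "R v p" "R v q"
  shows "path_equiv (dowker (R\<inverse>\<inverse>)) (xs @ p # \<omega> @ [r]) (xs @ p # q # \<omega> @ [r])"
proof -
  obtain s ys where s: "\<omega> @ [r] = s # ys" by (cases "\<omega> @ [r]") auto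
  then have "R v s" using witnesses_hd[OF assms(1,2)] by simp
  then show ?thesis
    using path_equiv_insert[of "R\<inverse>\<inverse>" q v p s xs ys] assms(3,4) s by simp
qed

text \<open>The first witnesses \<open>q\<close> and \<open>q'\<close> of the edge from \<open>v\<close> to \<open>w\<close> are exchanged in two
  steps: \<open>q'\<close> is inserted between \<open>p\<close> and \<open>q\<close>, the three being related to \<open>v\<close>, and then \<open>q\<close> is
  removed, as \<open>q'\<close>, \<open>q\<close> and the entry after \<open>q\<close> are related to \<open>w\<close>.\<close>

lemma witness_path_unique:
  assumes "witnesses R L \<omega>" "witnesses R L \<omega>'" "R (hd L) p" "R (last L) r"
  shows "path_equiv (dowker (R\<inverse>\<inverse>)) (p # \<omega> @ [r]) (p # \<omega>' @ [r])"
  using assms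
proof (induction R L \<omega> arbitrary: p \<omega>' rule: witnesses.induct)
  case (1 R v)
  then show ?case by (cases \<omega>') auto
next
  case (2 R v w L q \<omega>)
  let ?E = "path_equiv (dowker (R\<inverse>\<inverse>))"
  from 2(3) obtain q' \<omega>'' where \<omega>': "\<omega>' = q' # \<omega>''" by (cases \<omega>') auto
  have q': "R v q'" "R w q'" "witnesses R (w # L) \<omega>''"
    and q: "R v q" "R w q" "witnesses R (w # L) \<omega>"
    and last: "R (last (w # L)) r"
    using 2(2-5) \<omega>' by auto
  have "?E (p # q # \<omega> @ [r]) (p # q' # q # \<omega> @ [r])"
    using path_equiv_insert[of "R\<inverse>\<inverse>" q' v p q "[]"] q q' 2(4) by simp
  moreover have "?E (p # q' # q # \<omega> @ [r]) (p # q' # \<omega> @ [r])"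
    using path_equiv_insert_witness[OF q(3) last q'(2) q(2), of "[p]"] by (simp add: equivclp_sym)
  moreover have "?E (q' # \<omega> @ [r]) (q' # \<omega>'' @ [r])"
    by (rule 2(1)[OF q(3) q'(3) _ last]) (simp add: q'(2))
  from equivclp_insertion_append[OF this, of "[p]" "[]"]
  have "?E (p # q' # \<omega> @ [r]) (p # q' # \<omega>'' @ [r])" by simp
  ultimately show ?case unfolding \<omega>' append_Cons by (meson equivclp_trans)
qed auto

text \<open>Inserting \<open>u\<close> between \<open>v\<close> and \<open>w\<close> replaces one edge by two; all three edges admit a common
  witness \<open>q\<close>, so with a suitable choice of witnesses the entry \<open>q\<close> is merely repeated.\<close>

lemma witness_path_insertion:
  assumes "simple_insertion (dowker R) L L'"
    and "witnesses R L \<omega>" "witnesses R L' \<omega>'" "R (hd L) p" "R (last L) r"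
  shows "path_equiv (dowker (R\<inverse>\<inverse>)) (p # \<omega> @ [r]) (p # \<omega>' @ [r])"
  using assms(1)
proof cases
  case (1 \<sigma> u v w xs ys)
  let ?E = "path_equiv (dowker (R\<inverse>\<inverse>))"
  obtain q where q: "R u q" "R v q" "R w q"
    using 1(3,4) by (auto simp: dowker_def)
  from assms(2) have "witnesses R (xs @ v # w # ys) \<omega>" by (simp add: 1)
  then obtain \<alpha> \<gamma> where \<alpha>: "witnesses R (xs @ [v]) \<alpha>" and \<gamma>: "witnesses R (v # w # ys) \<gamma>"
    by (rule witnesses_appendE)
  from \<gamma> obtain \<beta> where \<beta>: "witnesses R (w # ys) \<beta>" by (cases \<gamma>) auto
  have last: "last L' = last L" "hd L' = hd L" "last (w # ys) = last L"
    by (cases xs; simp add: 1)+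
  have L: "witnesses R L (\<alpha> @ q # \<beta>)"
    using witnesses_append[OF \<alpha>, of "w # ys" "q # \<beta>"] q \<beta> by (simp add: 1)
  have L': "witnesses R L' (\<alpha> @ q # q # \<beta>)"
    using witnesses_append[OF \<alpha>, of "u # w # ys" "q # q # \<beta>"] q \<beta> by (simp add: 1)
  have "?E (p # \<omega> @ [r]) (p # (\<alpha> @ q # \<beta>) @ [r])"
    using assms L by (intro witness_path_unique)
  moreover have "?E (p # (\<alpha> @ q # \<beta>) @ [r]) (p # (\<alpha> @ q # q # \<beta>) @ [r])"
    using path_equiv_insert_witness[OF \<beta>, of r q q "p # \<alpha>"] q assms(5) last by simp
  moreover have "?E (p # (\<alpha> @ q # q # \<beta>) @ [r]) (p # \<omega>' @ [r])"
    by (rule witness_path_unique[OF L' assms(3)]) (simp_all add: assms last)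
  ultimately show ?thesis by (meson equivclp_trans)
qed

lemma witness_path_homotopic:
  assumes K: "simplicial_complex (dowker R)"
    and E: "path_equiv (dowker R) L L'" "edge_path (dowker R) L"
    and W: "witnesses R L \<omega>" "witnesses R L' \<omega>'" "R (hd L) p" "R (last L) r"
  shows "path_equiv (dowker (R\<inverse>\<inverse>)) (p # \<omega> @ [r]) (p # \<omega>' @ [r])"
  using E(1) W(2)
proof (induction arbitrary: \<omega>' rule: equivclp_induct)
  case base
  then show ?case using W by (intro witness_path_unique)
next
  case (step M N)
  note facts = equivclp_insertion_facts[OF K step(1)]
  then obtain \<mu> where \<mu>: "witnesses R M \<mu>"
    using E(2) by (auto simp: edge_path_dowker_iff)
  have ends: "R (hd M) p" "R (last M) r" using facts W by auto
  have "path_equiv (dowker (R\<inverse>\<inverse>)) (p # \<mu> @ [r]) (p # \<omega>' @ [r])"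
    using step(2)
  proof
    assume "simple_insertion (dowker R) M N"
    then show ?thesis using witness_path_insertion \<mu> step.prems ends by metis
  next
    assume NM: "simple_insertion (dowker R) N M"
    then have "R (hd N) p" "R (last N) r" using simple_insertion_facts[OF K NM] ends by auto
    then show ?thesis using witness_path_insertion[OF NM step.prems \<mu>] by (simp add: equivclp_sym)
  qed
  then show ?case using step.IH[OF \<mu>] by (rule equivclp_trans[rotated])
qed

text \<open>Passing to witnesses twice turns the loop \<open>L\<close> into \<open>b, L, b\<close>; this is the homotopy back.\<close>

lemma path_equiv_repeat_ends:
  assumes "edge_loop (dowker R) b L"
  shows "path_equiv (dowker R) (b # L @ [b]) L"
proof -
  let ?E = "path_equiv (dowker R)"
  obtain c cs where L: "L = b # c # cs"
    using assms by (cases L; cases "tl L") (auto simp: edge_loop_def edge_path_def)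
  have "{b, c} \<in> simplices (dowker R)"
    using assms L by (simp add: edge_loop_def edge_path_def)
  then obtain y where y: "R b y" "R c y" by (auto simp: dowker_def)
  obtain ds where ds: "L @ [b] = ds @ [b, b]" "L = ds @ [b]"
    using assms L by (metis append_butlast_last_id append.assoc append_Cons append_Nil
      edge_loop_def list.distinct(1))
  obtain es d where es: "L = es @ [d, b]"
    using ds(2) L by (cases ds rule: rev_cases) auto
  have "{d, b} \<in> simplices (dowker R)"
    using assms es by (simp add: edge_loop_def edge_path_def successively_append_iff)
  then obtain z where z: "R d z" "R b z" by (auto simp: dowker_def)
  have "?E L (L @ [b])"
    using path_equiv_insert[of R b z d b es "[]"] z es by simp
  moreover have "?E (L @ [b]) (b # L @ [b])"
    using path_equiv_insert[of R b y b c "[]" "cs @ [b]"] y L by simp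
  ultimately show ?thesis by (meson equivclp_sym equivclp_trans)
qed


section \<open>Dowker duality for edge-path groups\<close>

lemma loop_rel_iff:
  "(P, Q) \<in> loop_rel K b \<longleftrightarrow> edge_loop K b P \<and> edge_loop K b Q \<and> path_equiv K P Q"
  by (auto simp: loop_rel_def homotopic_paths_def edge_loop_def)

lemma loop_class_eq_iff:
  assumes "edge_loop K b P" "edge_loop K b Q"
  shows "loop_class K b P = loop_class K b Q \<longleftrightarrow> path_equiv K P Q"
  using eq_equiv_class_iff[OF equiv_loop_rel, of P K b Q] assms by (simp add: loop_rel_iff)

lemma carrier_fundamental_group:
  "A \<in> carrier (fundamental_group K b) \<longleftrightarrow> (\<exists>P. edge_loop K b P \<and> A = loop_class K b P)"
  by (auto simp: fundamental_group_def quotient_def)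

text \<open>As for \<open>eta_star\<close>, the union over all representatives and all choices avoids making a choice;
  \<open>witness_map_class\<close> shows that all members of the union agree.\<close>

definition witness_map :: "('a \<Rightarrow> 'b \<Rightarrow> bool) \<Rightarrow> 'b \<Rightarrow> 'a list set \<Rightarrow> 'b list set" where
  "witness_map R p A =
     (\<Union>L\<in>A. \<Union>\<omega>\<in>{\<omega>. witnesses R L \<omega>}. loop_class (dowker (R\<inverse>\<inverse>)) p (p # \<omega> @ [p]))"

lemma edge_loop_witnesses:
  assumes "edge_loop K b L" "R b p" "witnesses R L \<omega>"
  shows "edge_loop (dowker (R\<inverse>\<inverse>)) p (p # \<omega> @ [p])"
  using edge_path_witnesses[OF assms(3), of p p] assms by (simp add: edge_loop_def)

lemma edge_loop_obtain_witnesses: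
  assumes "edge_loop (dowker R) b L"
  obtains \<omega> where "witnesses R L \<omega>"
  using assms by (auto simp: edge_loop_def edge_path_dowker_iff)

lemma witness_map_class:
  assumes K: "simplicial_complex (dowker R)" and b: "R b p"
    and L: "edge_loop (dowker R) b L" "witnesses R L \<omega>"
  shows "witness_map R p (loop_class (dowker R) b L) =
    loop_class (dowker (R\<inverse>\<inverse>)) p (p # \<omega> @ [p])" (is "_ = ?C \<omega>")
proof -
  have eq: "?C \<omega>' = ?C \<omega>" if L': "L' \<in> loop_class (dowker R) b L" "witnesses R L' \<omega>'" for L' \<omega>'
  proof -
    have *: "edge_loop (dowker R) b L'" "path_equiv (dowker R) L' L"
      using L' by (auto simp: loop_rel_iff equivclp_sym)
    then have "path_equiv (dowker (R\<inverse>\<inverse>)) (p # \<omega>' @ [p]) (p # \<omega> @ [p])"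
      using b L L'(2) by (intro witness_path_homotopic[OF K]) (auto simp: edge_loop_def)
    then show ?thesis
      using loop_class_eq_iff edge_loop_witnesses *(1) L L'(2) b by metis
  qed
  moreover have "L \<in> loop_class (dowker R) b L" using L by (simp add: loop_rel_iff)
  ultimately show ?thesis
    using L(2) unfolding witness_map_def by blast
qed

text \<open>Both halves of bijectivity read a loop as a sequence of witnesses of its own witnesses. For
  injectivity, a homotopy between the images of \<open>L\<close> and \<open>M\<close> is carried back by the construction for
  the converse relation, with \<open>L\<close> and \<open>M\<close> as the choices of witnesses. For surjectivity, a
  preimage of \<open>Q\<close> is formed from any witnesses of \<open>Q\<close>.\<close>

theorem witness_map_iso:
  assumes K: "simplicial_complex (dowker R)" and K': "simplicial_complex (dowker (R\<inverse>\<inverse>))"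
    and b: "R b p"
  shows "witness_map R p \<in>
    iso (fundamental_group (dowker R) b) (fundamental_group (dowker (R\<inverse>\<inverse>)) p)"
    (is "?f \<in> iso ?G ?H")
proof -
  let ?c = "loop_class (dowker R) b" and ?c' = "loop_class (dowker (R\<inverse>\<inverse>)) p"
  note map = witness_map_class[OF K b]
  have b': "(R\<inverse>\<inverse>) p b" using b by simp
  have car: "?f A \<in> carrier ?H" if "A \<in> carrier ?G" for A
  proof -
    from that obtain L where L: "edge_loop (dowker R) b L" "A = ?c L"
      by (auto simp: carrier_fundamental_group)
    from L(1) obtain \<omega> where \<omega>: "witnesses R L \<omega>" by (rule edge_loop_obtain_witnesses)
    show ?thesis
      using map[OF L(1) \<omega>] edge_loop_witnesses[OF L(1) b \<omega>] L(2)
      by (auto simp: carrier_fundamental_group)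
  qed
  have mult: "?f (A \<otimes>\<^bsub>?G\<^esub> B) = ?f A \<otimes>\<^bsub>?H\<^esub> ?f B" if "A \<in> carrier ?G" "B \<in> carrier ?G" for A B
  proof -
    from that obtain L M where L: "edge_loop (dowker R) b L" "A = ?c L"
      and M: "edge_loop (dowker R) b M" "B = ?c M"
      by (auto simp: carrier_fundamental_group)
    from L(1) obtain \<omega> where \<omega>: "witnesses R L \<omega>" by (rule edge_loop_obtain_witnesses)
    from M(1) obtain \<mu> where \<mu>: "witnesses R M \<mu>" by (rule edge_loop_obtain_witnesses)
    obtain l where l: "L = l @ [b]"
      using L(1) by (cases L rule: rev_cases) (auto simp: edge_loop_def edge_path_def)
    obtain m where m: "M = b # m"
      using M(1) by (cases M) (auto simp: edge_loop_def edge_path_def)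
    have LM: "edge_loop (dowker R) b (L @ tl M)" by (rule edge_loop_append[OF L(1) M(1)])
    have \<omega>\<mu>: "witnesses R (L @ tl M) (\<omega> @ \<mu>)"
      using witnesses_append[of R l b \<omega> m \<mu>] \<omega> \<mu> l m by simp
    note loops = edge_loop_witnesses[OF L(1) b \<omega>] edge_loop_witnesses[OF M(1) b \<mu>]
      edge_loop_witnesses[OF LM b \<omega>\<mu>]
    \<comment> \<open>The two loops to be compared differ by an entry \<open>p\<close> between \<open>\<omega>\<close> and \<open>\<mu>\<close>. It can be
      inserted because it, the entry before it and the entry after it are all related to \<open>b\<close>. The
      entry before it is taken to be the last one of \<open>p, \<omega>\<close>, which exists in any case.\<close>
    obtain q \<alpha> where q: "p # \<omega> = \<alpha> @ [q]" by (metis append_butlast_last_id list.distinct(1))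
    have q_append: "\<alpha> @ q # ys = p # \<omega> @ ys" for ys
      by (metis append.assoc append_Cons append_Nil q)
    have "witnesses (R\<inverse>\<inverse>) (p # \<omega> @ [p]) (l @ [b])"
      using witnesses_dual[of R L \<omega> p p] \<omega> L(1) b l by (simp add: edge_loop_def)
    then have "witnesses (R\<inverse>\<inverse>) (\<alpha> @ q # [p]) (l @ [b])" by (simp add: q_append)
    then obtain \<beta> \<gamma> where \<gamma>: "l @ [b] = \<beta> @ \<gamma>" "witnesses (R\<inverse>\<inverse>) [q, p] \<gamma>"
      by (rule witnesses_appendE)
    then have "R b q" by (cases \<gamma>; cases "tl \<gamma>") auto
    moreover have "R (last (b # m)) p" using M(1) m b by (simp add: edge_loop_def)
    ultimately have "path_equiv (dowker (R\<inverse>\<inverse>)) (\<alpha> @ q # \<mu> @ [p]) (\<alpha> @ q # p # \<mu> @ [p])"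
      using path_equiv_insert_witness[of R b m \<mu> p q p \<alpha>] \<mu> m b by simp
    then have "path_equiv (dowker (R\<inverse>\<inverse>)) (p # (\<omega> @ \<mu>) @ [p]) ((p # \<omega> @ [p]) @ tl (p # \<mu> @ [p]))"
      by (simp add: q_append)
    then have "?c' (p # (\<omega> @ \<mu>) @ [p]) = ?c' ((p # \<omega> @ [p]) @ tl (p # \<mu> @ [p]))"
      using loop_class_eq_iff[OF loops(3) edge_loop_append[OF loops(1,2)]] by simp
    then show ?thesis
      using map[OF L(1) \<omega>] map[OF M(1) \<mu>] map[OF LM \<omega>\<mu>] L(2) M(2)
        fundamental_group_mult[OF L(1) M(1)] fundamental_group_mult[OF loops(1,2)] by simp
  qed
  have inj: "inj_on ?f (carrier ?G)"
  proof (rule inj_onI)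
    fix A B assume "A \<in> carrier ?G" "B \<in> carrier ?G" and eq: "?f A = ?f B"
    then obtain L M where L: "edge_loop (dowker R) b L" "A = ?c L"
      and M: "edge_loop (dowker R) b M" "B = ?c M"
      by (auto simp: carrier_fundamental_group)
    from L(1) obtain \<omega> where \<omega>: "witnesses R L \<omega>" by (rule edge_loop_obtain_witnesses)
    from M(1) obtain \<mu> where \<mu>: "witnesses R M \<mu>" by (rule edge_loop_obtain_witnesses)
    note loops = edge_loop_witnesses[OF L(1) b \<omega>] edge_loop_witnesses[OF M(1) b \<mu>]
    have "path_equiv (dowker (R\<inverse>\<inverse>)) (p # \<omega> @ [p]) (p # \<mu> @ [p])"
      using eq map[OF L(1) \<omega>] map[OF M(1) \<mu>] L(2) M(2) loop_class_eq_iff[OF loops] by simp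
    moreover have "witnesses (R\<inverse>\<inverse>) (p # \<omega> @ [p]) L" "witnesses (R\<inverse>\<inverse>) (p # \<mu> @ [p]) M"
      using witnesses_dual \<omega> \<mu> b L(1) M(1) unfolding edge_loop_def by metis+
    ultimately have "path_equiv (dowker R) (b # L @ [b]) (b # M @ [b])"
      using witness_path_homotopic[OF K', of "p # \<omega> @ [p]" "p # \<mu> @ [p]" L M b b] loops(1) b
      by (simp add: edge_loop_def)
    then have "path_equiv (dowker R) L M"
      using path_equiv_repeat_ends[OF L(1)] path_equiv_repeat_ends[OF M(1)]
      by (meson equivclp_sym equivclp_trans)
    then show "A = B" using loop_class_eq_iff[OF L(1) M(1)] L M by simp
  qed
  have surj: "\<exists>A\<in>carrier ?G. ?f A = C" if "C \<in> carrier ?H" for C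
  proof -
    from that obtain Q where Q: "edge_loop (dowker (R\<inverse>\<inverse>)) p Q" "C = ?c' Q"
      by (auto simp: carrier_fundamental_group)
    from Q(1) obtain l where l: "witnesses (R\<inverse>\<inverse>) Q l" by (rule edge_loop_obtain_witnesses)
    have L: "edge_loop (dowker R) b (b # l @ [b])"
      using edge_loop_witnesses[OF Q(1) b' l] by simp
    have "witnesses R (b # l @ [b]) Q"
      using witnesses_dual[OF l, of b b] Q(1) b by (simp add: edge_loop_def)
    from map[OF L this] edge_loop_witnesses[OF L b this]
    have "?f (?c (b # l @ [b])) = ?c' Q"
      using path_equiv_repeat_ends[OF Q(1)] loop_class_eq_iff[OF _ Q(1)] by simp
    moreover have "?c (b # l @ [b]) \<in> carrier ?G"
      using L by (auto simp: carrier_fundamental_group)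
    ultimately show ?thesis using Q(2) by metis
  qed
  show ?thesis
    using car mult inj surj by (force simp: iso_def hom_def bij_betw_def)
qed


section \<open>The divisor complexes of a set of integers\<close>

definition prime_divisor_of :: "nat set \<Rightarrow> nat \<Rightarrow> nat \<Rightarrow> bool" where
  "prime_divisor_of X v q \<longleftrightarrow> v \<in> X \<and> prime q \<and> q dvd v"

lemma common_divisor_complex_eq_dowker:
  assumes "\<forall>x\<in>X. 0 < x"
  shows "common_divisor_complex X = dowker (prime_divisor_of X)"
proof -
  have "(\<exists>q. prime_divisor_of X v q) \<longleftrightarrow> v \<in> X - {1}" for v
    using prime_factor_nat[of v] by (auto simp: prime_divisor_of_def)
  moreover have "V \<noteq> {} \<and> V \<subseteq> X - {1} \<and> Gcd V > 1 \<longleftrightarrow>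
      V \<noteq> {} \<and> (\<exists>q. \<forall>v\<in>V. prime_divisor_of X v q)" (is "?l \<longleftrightarrow> ?r") for V
  proof
    assume V: ?l
    then obtain q where q: "prime q" "q dvd Gcd V"
      using prime_factor_nat[of "Gcd V"] by auto
    then have "\<forall>v\<in>V. q dvd v" using Gcd_dvd dvd_trans by blast
    then show ?r using V q by (auto simp: prime_divisor_of_def)
  next
    assume V: ?r
    then obtain q where q: "prime q" "\<forall>v\<in>V. q dvd v" "V \<subseteq> X"
      by (auto simp: prime_divisor_of_def)
    obtain v where v: "v \<in> V" using V by auto
    then have "0 < v" using assms q by auto
    \<comment> \<open>A positive member rules out \<open>Gcd V = 0\<close>, for which \<open>q dvd Gcd V\<close> would bound nothing.\<close>
    then have "Gcd V \<noteq> 0" using v by (metis Gcd_dvd dvd_0_left_iff less_irrefl)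
    moreover have "q dvd Gcd V" using q by (intro Gcd_greatest) auto
    ultimately have "q \<le> Gcd V" by (meson dvd_imp_le neq0_conv)
    then have "Gcd V > 1" using prime_gt_1_nat[OF q(1)] by simp
    moreover have "1 \<notin> V" using q by auto
    ultimately show ?l using V q(3) by auto
  qed
  ultimately show ?thesis by (simp add: common_divisor_complex_def dowker_def set_diff_eq)
qed

lemma prime_divisor_complex_eq_dowker:
  "prime_divisor_complex X = dowker ((prime_divisor_of X)\<inverse>\<inverse>)"
proof -
  have "(\<exists>v. prime_divisor_of X v q) \<longleftrightarrow> prime q \<and> (\<exists>x\<in>X - {1}. q dvd x)" for q
    by (auto simp: prime_divisor_of_def)
  moreover have "Q \<noteq> {} \<and> Q \<subseteq> {q. prime q \<and> (\<exists>x\<in>X - {1}. q dvd x)} \<and> (\<exists>v\<in>X. \<forall>q\<in>Q. q dvd v) \<longleftrightarrow>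
      Q \<noteq> {} \<and> (\<exists>v. \<forall>q\<in>Q. prime_divisor_of X v q)" (is "?l \<longleftrightarrow> ?r") for Q
  proof
    assume ?l
    then show ?r unfolding prime_divisor_of_def by blast
  next
    assume Q: ?r
    then obtain v where v: "\<forall>q\<in>Q. v \<in> X \<and> prime q \<and> q dvd v"
      unfolding prime_divisor_of_def by blast
    then have "v \<in> X - {1}" using Q by fastforce
    then show ?l using Q v by blast
  qed
  ultimately show ?thesis by (simp add: prime_divisor_complex_def dowker_def)
qed

lemma eta_choice_iff_witnesses:
  assumes "L \<noteq> []" "set L \<subseteq> X"
  shows "eta_choice L \<omega> \<longleftrightarrow> witnesses (prime_divisor_of X) L \<omega>"
  using assms
proof (induction "prime_divisor_of X" L \<omega> rule: witnesses.induct)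
  case (2 v w L q \<omega>)
  have "eta_choice (v # w # L) (q # \<omega>) \<longleftrightarrow> q \<in> eta {v, w} \<and> eta_choice (w # L) \<omega>"
    by (auto simp: eta_choice_def less_Suc_eq_0_disj)
  then show ?case using 2 by (auto simp: eta_def prime_divisor_of_def)
qed (auto simp: eta_choice_def)

lemma edge_path_vertices:
  assumes "simplicial_complex K" "edge_path K P"
  shows "set P \<subseteq> vertices K"
proof -
  have "set P \<subseteq> vertices K"
    if "successively (\<lambda>v w. {v, w} \<in> simplices K) P" "2 \<le> length P"
    using that
  proof (induction P rule: induct_list012)
    case (3 v w P)
    then have "{v, w} \<subseteq> vertices K" using assms(1) by (auto simp: simplicial_complex_def)
    then show ?case using 3 by (cases P) auto
  qed auto
  then show ?thesis using assms(2) by (simp add: edge_path_def)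
qed

theorem corollary4p10:
  fixes X :: "nat set" and b p :: nat
  assumes "finite X"
    and "\<forall>x\<in>X. 0 < x"
    and "edge_connected (common_divisor_complex X)"
    and "b \<in> vertices (common_divisor_complex X)"
    and "prime p"
    and "p dvd b"
  shows "eta_star X p \<in> iso (fundamental_group (common_divisor_complex X) b)
                            (fundamental_group (prime_divisor_complex X) p)"
proof -
  let ?R = "prime_divisor_of X"
  note G = common_divisor_complex_eq_dowker[OF assms(2)]
  note D = prime_divisor_complex_eq_dowker[of X]
  have K: "simplicial_complex (dowker ?R)" "simplicial_complex (dowker (?R\<inverse>\<inverse>))"
    using simplicial_complex_common_divisor simplicial_complex_prime_divisor assms(1,2) G D by metis+
  have "?R b p"
    using assms(4-6) by (auto simp: common_divisor_complex_def prime_divisor_of_def)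
  then have iso: "witness_map ?R p \<in>
      iso (fundamental_group (dowker ?R) b) (fundamental_group (dowker (?R\<inverse>\<inverse>)) p)"
    using K by (intro witness_map_iso)
  have "eta_star X p A = witness_map ?R p A" if "A \<in> carrier (fundamental_group (dowker ?R) b)" for A
  proof -
    have "eta_choice L \<omega> \<longleftrightarrow> witnesses ?R L \<omega>" if "L \<in> A" for L \<omega>
    proof (rule eta_choice_iff_witnesses)
      have L: "edge_path (dowker ?R) L"
        using that \<open>A \<in> _\<close> by (auto simp: carrier_fundamental_group loop_rel_iff edge_loop_def)
      then show "L \<noteq> []" by (auto simp: edge_path_def)
      show "set L \<subseteq> X"
        using edge_path_vertices[OF K(1) L] by (auto simp: dowker_def prime_divisor_of_def)
    qed
    then show ?thesis by (simp add: witness_map_def eta_star_def D)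
  qed
  moreover have "group (fundamental_group (dowker ?R) b)"
    using group_fundamental_group[OF K(1)] assms(4) G by simp
  ultimately have "eta_star X p \<in>
      iso (fundamental_group (dowker ?R) b) (fundamental_group (dowker (?R\<inverse>\<inverse>)) p)"
    using group.iso_eq[OF _ iso] by metis
  then show ?thesis by (simp add: G D)
qed

end
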